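(* Suppose $\mathbf n$ has $l$-bounded quotient gaps, and let $\mathcal B$ be a Schauder basis of $\mathbb X$ with basis constant $\mathbf K$. Then: (i) If $\mathcal B$ is $\Delta_d$-$\mathbf n$-democratic, it is $\mathbf C$-democratic with $\mathbf C\le\max\{(n_1-1)\alpha_1\alpha_2,\ l\mathbf K\Delta_d\}$. (ii) If $\mathcal B$ is $\Delta_s$-$\mathbf n$-superdemocratic, it is $\mathbf C$-superdemocratic with $\mathbf C\le\max\{(n_1-1)\alpha_1\alpha_2,\ l\mathbf K\Delta_s\}$.
   Context: $\mathbb X$ is a separable infinite-dimensional Banach space over $\mathbb F=\mathbb R$ or $\mathbb C$, with dual $\mathbb X^*$. A basis of $\mathbb X$ is a sequence $\mathcal B=(\mathbf e_i)_{i\in\mathbb N}\subset\mathbb X$ with closed linear span $\mathbb X$, having a (unique) sequence of biorthogonal functionals $(\mathbf e_i^* )_{i\in\mathbb N}\subset\mathbb X^*$ ($\mathbf e_k^*(\mathbf e_i)=\delta_{k,i}$), with $0<\inf_i\min\{\|\mathbf e_i\|,\|\mathbf e_i^*\|\}\le\sup_i\max\{\|\mathbf e_i\|,\|\mathbf e_i^*\|\}<\infty$. Put $\alpha_1=\sup_i\|\mathbf e_i\|$, $\alpha_2=\sup_i\|\mathbf e_i^*\|$. The basis is Schauder if it is total ($\mathbf e_i^*(x)=0$ for all $i$ implies $x=0$) and there is $\mathbf C>0$ with $\|\sum_{i=1}^m\mathbf e_i^*(x)\mathbf e_i\|\le\mathbf C\|x\|$ for all $x\in\mathbb X$, $m\in\mathbb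 N$; the least such $\mathbf C$ is its basis constant. $\mathbf n=(n_k)_{k\in\mathbb N}$ is a strictly increasing sequence of positive integers, also regarded as a subset of $\mathbb N$ ($\mathbf n=\mathbb N$ is allowed). For an integer $l\ge2$, $\mathbf n$ has $l$-bounded quotient gaps if $n_{k+1}/n_k\le l$ for all $k$. For a finite $A\subset\mathbb N$, $\Psi_A$ is the set of families $\varepsilon=(\varepsilon_n)_{n\in A}\subset\mathbb F$ with $|\varepsilon_n|=1$, $\mathbf 1_{\varepsilon A}=\sum_{n\in A}\varepsilon_n\mathbf e_n$ and $\mathbf 1_A=\sum_{n\in A}\mathbf e_n$. $\mathcal B$ is $\mathbf n$-superdemocratic if there is $\mathbf C>0$ with $\|\mathbf 1_{\varepsilon A}\|\le\mathbf C\|\mathbf 1_{\varepsilon'B}\|$ for all $A,B\subset\mathbb N$ with $|A|\le|B|$, $|A|,|B|\in\mathbf n$, and all $\varepsilon\in\Psi_A$, $\varepsilon'\in\Psi_B$; it is $\Delta_s$-$\mathbf n$-superdemocratic if $\Delta_s$ is the smallest such constant. $\mathcal B$ is $\Delta_d$-$\mathbf n$-democratic if $\Delta_d$ is the smallest constant for which the inequality holds with $\varepsilon\equiv\varepsilon'\equiv1$. The prefix $\mathbf n$ is omitted when $\mathbf n=\mathbb N$. *)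

theory Defs
  imports "HOL-Analysis.Analysis"
begin

text \<open>
  There is no library class of normed spaces over a variable scalar field.  The field is a type
  \<open>'k\<close> of class \<^class>\<open>real_normed_field\<close>: its instances are, up to isometric isomorphism, exactly
  the real and the complex numbers (Ostrowski, Gelfand--Mazur).  The norm, topology and
  completeness come from the class \<^class>\<open>banach\<close>; for \<open>'k = real\<close> the last axiom forces
  \<open>scl = (*\<^sub>R)\<close>, for \<open>'k = complex\<close> the locale describes complex Banach spaces.
\<close>

locale banach_space_over = vector_space scl
  for scl :: "'k::real_normed_field \<Rightarrow> 'a::banach \<Rightarrow> 'a" +
  assumes norm_scl: "norm (scl c x) = norm c * norm x"
    and scl_of_real: "scl (of_real r) x = r *\<^sub>R x"

definition separable_inf_dim ::
    "('k::real_normed_field \<Rightarrow> 'a::banach \<Rightarrow> 'a) \<Rightarrow> bool" where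
  "separable_inf_dim scl \<longleftrightarrow>
     (\<exists>S::'a set. countable S \<and> closure S = UNIV) \<and>
     \<not> (\<exists>S. finite S \<and> module.span scl S = UNIV)"

definition dual_functional ::
    "('k::real_normed_field \<Rightarrow> 'a::banach \<Rightarrow> 'a) \<Rightarrow> ('a \<Rightarrow> 'k) \<Rightarrow> bool" where
  "dual_functional scl f \<longleftrightarrow> Vector_Spaces.linear scl (*) f \<and> bounded_linear f"

text \<open>
  The biorthogonal functionals \<open>es\<close> are a parameter; they are determined by \<open>e\<close>
  because the span of \<open>e\<close> is dense.  Their dual norm is \<^const>\<open>onorm\<close>.  All sequences are
  indexed from 0.
\<close>

definition is_basis ::
    "('k::real_normed_field \<Rightarrow> 'a::banach \<Rightarrow> 'a) \<Rightarrow> (nat \<Rightarrow> 'a) \<Rightarrow> (nat \<Rightarrow> 'a \<Rightarrow> 'k) \<Rightarrow> bool" where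
  "is_basis scl e es \<longleftrightarrow>
     closure (module.span scl (range e)) = UNIV \<and>
     (\<forall>i. dual_functional scl (es i)) \<and>
     (\<forall>k i. es k (e i) = (if k = i then 1 else 0)) \<and>
     0 < (INF i. min (norm (e i)) (onorm (es i))) \<and>
     bdd_above (range (\<lambda>i. max (norm (e i)) (onorm (es i))))"

definition alpha1 :: "(nat \<Rightarrow> 'a::banach) \<Rightarrow> real" where
  "alpha1 e = (SUP i. norm (e i))"

definition alpha2 :: "(nat \<Rightarrow> 'a::banach \<Rightarrow> 'k::real_normed_field) \<Rightarrow> real" where
  "alpha2 es = (SUP i. onorm (es i))"

definition is_least :: "(real \<Rightarrow> bool) \<Rightarrow> real \<Rightarrow> bool" where
  "is_least P C \<longleftrightarrow> P C \<and> (\<forall>C'. P C' \<longrightarrow> C \<le> C')"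

definition partial_sums_bounded_by ::
    "('k::real_normed_field \<Rightarrow> 'a::banach \<Rightarrow> 'a) \<Rightarrow> (nat \<Rightarrow> 'a) \<Rightarrow> (nat \<Rightarrow> 'a \<Rightarrow> 'k) \<Rightarrow> real \<Rightarrow> bool" where
  "partial_sums_bounded_by scl e es C \<longleftrightarrow>
     C > 0 \<and> (\<forall>x m. norm (\<Sum>i<m. scl (es i x) (e i)) \<le> C * norm x)"

definition schauder_basis ::
    "('k::real_normed_field \<Rightarrow> 'a::banach \<Rightarrow> 'a) \<Rightarrow> (nat \<Rightarrow> 'a) \<Rightarrow> (nat \<Rightarrow> 'a \<Rightarrow> 'k) \<Rightarrow> bool" where
  "schauder_basis scl e es \<longleftrightarrow>
     is_basis scl e es \<and>
     (\<forall>x. (\<forall>i. es i x = 0) \<longrightarrow> x = 0) \<and>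
     (\<exists>C. partial_sums_bounded_by scl e es C)"

definition basis_constant ::
    "('k::real_normed_field \<Rightarrow> 'a::banach \<Rightarrow> 'a) \<Rightarrow> (nat \<Rightarrow> 'a) \<Rightarrow> (nat \<Rightarrow> 'a \<Rightarrow> 'k) \<Rightarrow> real \<Rightarrow> bool" where
  "basis_constant scl e es K \<longleftrightarrow> is_least (partial_sums_bounded_by scl e es) K"

definition bounded_quotient_gaps :: "nat \<Rightarrow> (nat \<Rightarrow> nat) \<Rightarrow> bool" where
  "bounded_quotient_gaps l n \<longleftrightarrow> (\<forall>k. real (n (Suc k)) / real (n k) \<le> real l)"

definition unimodular :: "nat set \<Rightarrow> (nat \<Rightarrow> 'k::real_normed_field) set" where
  "unimodular A = {\<epsilon>. \<forall>i\<in>A. norm (\<epsilon> i) = 1}"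

definition signed_indicator_sum ::
    "('k::real_normed_field \<Rightarrow> 'a::banach \<Rightarrow> 'a) \<Rightarrow> (nat \<Rightarrow> 'a) \<Rightarrow> (nat \<Rightarrow> 'k) \<Rightarrow> nat set \<Rightarrow> 'a" where
  "signed_indicator_sum scl e \<epsilon> A = (\<Sum>i\<in>A. scl (\<epsilon> i) (e i))"

definition indicator_sum :: "(nat \<Rightarrow> 'a::banach) \<Rightarrow> nat set \<Rightarrow> 'a" where
  "indicator_sum e A = (\<Sum>i\<in>A. e i)"

text \<open>
  In the following notions \<open>N\<close> is the set of admissible cardinalities; the unrestricted notions
  are those with \<open>N\<close> the set of all positive integers.
\<close>

definition superdemocratic_bound ::
    "nat set \<Rightarrow> ('k::real_normed_field \<Rightarrow> 'a::banach \<Rightarrow> 'a) \<Rightarrow> (nat \<Rightarrow> 'a) \<Rightarrow> real \<Rightarrow> bool" where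
  "superdemocratic_bound N scl e C \<longleftrightarrow>
     C > 0 \<and>
     (\<forall>A B. finite A \<and> finite B \<and> card A \<le> card B \<and> card A \<in> N \<and> card B \<in> N \<longrightarrow>
       (\<forall>\<epsilon>\<in>unimodular A. \<forall>\<epsilon>'\<in>unimodular B.
         norm (signed_indicator_sum scl e \<epsilon> A) \<le> C * norm (signed_indicator_sum scl e \<epsilon>' B)))"

definition superdemocratic_with ::
    "nat set \<Rightarrow> ('k::real_normed_field \<Rightarrow> 'a::banach \<Rightarrow> 'a) \<Rightarrow> (nat \<Rightarrow> 'a) \<Rightarrow> real \<Rightarrow> bool" where
  "superdemocratic_with N scl e D \<longleftrightarrow> is_least (superdemocratic_bound N scl e) D"

definition democratic_bound :: "nat set \<Rightarrow> (nat \<Rightarrow> 'a::banach) \<Rightarrow> real \<Rightarrow> bool" where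
  "democratic_bound N e C \<longleftrightarrow>
     C > 0 \<and>
     (\<forall>A B. finite A \<and> finite B \<and> card A \<le> card B \<and> card A \<in> N \<and> card B \<in> N \<longrightarrow>
       norm (indicator_sum e A) \<le> C * norm (indicator_sum e B))"

definition democratic_with :: "nat set \<Rightarrow> (nat \<Rightarrow> 'a::banach) \<Rightarrow> real \<Rightarrow> bool" where
  "democratic_with N e D \<longleftrightarrow> is_least (democratic_bound N e) D"

end

theory Submission
  imports Defs
begin

text \<open>
  Democracy and superdemocracy differ only in which coefficient families are admitted, so both
  parts are one argument about an arbitrary class of unimodular families that is stable under
  shrinking the index set.

  Let \<open>A\<close> and \<open>B\<close> be nonempty with \<open>card A \<le> card B\<close>.  If \<open>card A\<close> lies below the smallest
  admissible cardinality, the triangle inequality bounds the numerator by \<open>card A * alpha1\<close>, and a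
  single coordinate functional bounds the denominator from below by \<open>1 / alpha2\<close>.  Otherwise pick
  consecutive terms \<open>n k \<le> card A < n (Suc k)\<close>.  A partial-sum projection cuts \<open>B\<close> down to its first
  \<open>n k\<close> elements at the price of a factor \<open>K\<close>.  On the other side, the sum over \<open>A\<close> is
  \<open>card A / n k\<close> times the average of the sums over the \<open>n k\<close>-element subsets of \<open>A\<close>, and each of
  these is controlled by the hypothesis; the gap condition gives \<open>card A / n k \<le> l\<close>.  Averaging,
  rather than partitioning \<open>A\<close>, avoids a remainder block of inadmissible size
  (\<open>norm_sum_le_by_subset_average\<close>).

  This shows that the maximum is an admissible constant.  That a smallest admissible constant exists
  is a separate point, because constants have to be positive: comparing a singleton with itself
  forces every admissible constant to be at least 1, so the infimum is positive, and the
  inequalities pass to it.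
\<close>

section \<open>Averaging over subsets of fixed cardinality\<close>

text \<open>
  Each element of \<open>A\<close> lies in the proportion \<open>s / card A\<close> of the \<open>s\<close>-element subsets.  Instead of
  counting those, the induction deletes one element at a time: each element of \<open>A\<close> survives in all
  but one of the sets \<open>A - {a}\<close>, whence \<open>(card A - 1) *\<^sub>R sum v A = (\<Sum>a\<in>A. sum v (A - {a}))\<close>.
\<close>

lemma norm_sum_le_by_subset_average:
  fixes v :: "'b \<Rightarrow> 'a::real_normed_vector"
  assumes "finite A" "0 < s" "s \<le> card A"
    and "\<And>S. S \<subseteq> A \<Longrightarrow> card S = s \<Longrightarrow> norm (sum v S) \<le> M"
  shows "real s * norm (sum v A) \<le> real (card A) * M"
  using assms
proof (induction "card A - s" arbitrary: A)
  case 0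
  then have "card A = s" by simp
  with 0 show ?case by (simp add: mult_left_mono)
next
  case (Suc d)
  let ?m = "real (card A) - 1"
  have gt: "s < card A" using Suc.hyps by simp
  then have m: "0 < ?m" using Suc.prems(2) by linarith
  have IH: "real s * norm (sum v (A - {a})) \<le> ?m * M" if "a \<in> A" for a
  proof -
    have c: "card (A - {a}) = card A - 1" using that Suc.prems(1) by simp
    have "real s * norm (sum v (A - {a})) \<le> real (card (A - {a})) * M"
    proof (rule Suc.hyps(1))
      show "d = card (A - {a}) - s" using Suc.hyps(2) c by simp
      show "s \<le> card (A - {a})" using gt c by simp
      fix S assume "S \<subseteq> A - {a}" "card S = s"
      then show "norm (sum v S) \<le> M" using Suc.prems(4) by blast
    qed (use Suc.prems in auto)
    also have "real (card (A - {a})) = ?m" using c gt by (simp add: of_nat_diff)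
    finally show ?thesis .
  qed
  have "(\<Sum>a\<in>A. sum v (A - {a})) = (\<Sum>a\<in>A. sum v A - v a)"
    using Suc.prems(1) by (intro sum.cong) (auto simp: sum_diff1)
  also have "\<dots> = ?m *\<^sub>R sum v A"
    by (simp add: sum_subtractf sum_constant_scaleR algebra_simps)
  finally have avg: "?m *\<^sub>R sum v A = (\<Sum>a\<in>A. sum v (A - {a}))" by simp
  have "?m * (real s * norm (sum v A)) = real s * norm (?m *\<^sub>R sum v A)"
    using m by simp
  also have "\<dots> \<le> real s * (\<Sum>a\<in>A. norm (sum v (A - {a})))"
    unfolding avg by (intro mult_left_mono norm_sum) simp
  also have "\<dots> = (\<Sum>a\<in>A. real s * norm (sum v (A - {a})))"
    by (rule sum_distrib_left)
  also have "\<dots> \<le> (\<Sum>a\<in>A. ?m * M)" by (intro sum_mono IH)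
  also have "\<dots> = ?m * (real (card A) * M)" by simp
  finally show ?case using m by simp
qed

lemma ex_initial_segment_card:
  fixes B :: "nat set"
  assumes "finite B" "s \<le> card B"
  shows "\<exists>m. card (B \<inter> {..<m}) = s"
  using assms
proof (induction B arbitrary: s rule: finite_linorder_max_induct)
  case empty
  then show ?case by simp
next
  case (insert b B)
  show ?case
  proof (cases "s \<le> card B")
    case True
    then obtain m where m: "card (B \<inter> {..<m}) = s" using insert.IH by blast
    have "insert b B \<inter> {..<min m b} = B \<inter> {..<m}" using insert.hyps by fastforce
    with m show ?thesis by metis
  next
    case False
    have "b \<notin> B" using insert.hyps by blast
    then have "s = card (insert b B)" using False insert by simp
    moreover have "insert b B \<inter> {..<Suc b} = insert b B" using insert.hyps by fastforce
    ultimately show ?thesis by metis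
  qed
qed

lemma strict_mono_bracket:
  fixes n :: "nat \<Rightarrow> nat"
  assumes "strict_mono n" "n 0 \<le> m"
  shows "\<exists>k. n k \<le> m \<and> m < n (Suc k)"
proof -
  have "m < n (Suc m)" using strict_mono_imp_increasing[OF assms(1), of "Suc m"] by simp
  then have ex: "\<exists>k. m < n (Suc k)" by blast
  define k where "k = (LEAST k. m < n (Suc k))"
  have "m < n (Suc k)" unfolding k_def using ex by (rule LeastI_ex)
  moreover have "n k \<le> m"
  proof (cases k)
    case 0
    then show ?thesis using assms by simp
  next
    case (Suc j)
    then have "\<not> m < n (Suc j)" unfolding k_def by (metis lessI not_less_Least)
    then show ?thesis using Suc by simp
  qed
  ultimately show ?thesis by blast
qed

section \<open>Democracy for a class of coefficient families\<close>

text \<open>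
  For \<open>U = unimodular\<close> this is the superdemocratic inequality; for the constant family 1 it is the
  democratic one.
\<close>

definition signed_democratic_bound ::
    "(nat set \<Rightarrow> (nat \<Rightarrow> 'k) set) \<Rightarrow> nat set \<Rightarrow>
      ('k::real_normed_field \<Rightarrow> 'a::banach \<Rightarrow> 'a) \<Rightarrow> (nat \<Rightarrow> 'a) \<Rightarrow> real \<Rightarrow> bool" where
  "signed_democratic_bound U N scl e C \<longleftrightarrow>
     C > 0 \<and>
     (\<forall>A B. finite A \<and> finite B \<and> card A \<le> card B \<and> card A \<in> N \<and> card B \<in> N \<longrightarrow>
       (\<forall>\<epsilon>\<in>U A. \<forall>\<epsilon>'\<in>U B.
         norm (signed_indicator_sum scl e \<epsilon> A) \<le> C * norm (signed_indicator_sum scl e \<epsilon>' B)))"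

lemma superdemocratic_bound_eq_signed:
  "superdemocratic_bound N scl e = signed_democratic_bound unimodular N scl e"
  by (intro ext) (simp add: superdemocratic_bound_def signed_democratic_bound_def)

lemma (in banach_space_over) democratic_bound_eq_signed:
  "democratic_bound N e = signed_democratic_bound (\<lambda>_. {\<lambda>_. 1}) N scl e"
  by (intro ext)
    (simp add: democratic_bound_def signed_democratic_bound_def indicator_sum_def
      signed_indicator_sum_def)

text \<open>
  A singleton compared with itself gives \<open>1 \<le> C\<close> for every admissible \<open>C\<close>, so the infimum of the
  admissible constants is positive.
\<close>

lemma (in banach_space_over) ex_least_signed_democratic_bound:
  assumes D: "signed_democratic_bound U N scl e D"
    and N: "1 \<in> N" and e: "e i \<noteq> 0"
    and \<epsilon>: "\<epsilon> \<in> U {i}" "norm (\<epsilon> i) = 1"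
  shows "\<exists>C. is_least (signed_democratic_bound U N scl e) C \<and> C \<le> D"
proof -
  let ?P = "signed_democratic_bound U N scl e"
  define C where "C = Inf (Collect ?P)"
  have one: "1 \<le> C'" if "?P C'" for C'
  proof -
    have "norm (signed_indicator_sum scl e \<epsilon> {i}) \<le> C' * norm (signed_indicator_sum scl e \<epsilon> {i})"
      using that N \<epsilon>(1) unfolding signed_democratic_bound_def by simp
    then have "norm (e i) \<le> C' * norm (e i)"
      by (simp add: signed_indicator_sum_def norm_scl \<epsilon>(2))
    then show ?thesis using e by simp
  qed
  have ne: "Collect ?P \<noteq> {}" using D by blast
  have bdd: "bdd_below (Collect ?P)" using one by (auto intro!: bdd_belowI)
  have le: "C \<le> C'" if "?P C'" for C'
    unfolding C_def using that bdd by (simp add: cInf_lower)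
  have "1 \<le> C" unfolding C_def using ne one by (intro cInf_greatest) auto
  moreover have "x \<le> C * y" if "\<And>C'. ?P C' \<Longrightarrow> x \<le> C' * y" "0 \<le> y" for x y
  proof (cases "y = 0")
    case True
    then show ?thesis using that(1)[OF D] by simp
  next
    case False
    then have y: "0 < y" using that(2) by simp
    have "x / y \<le> C"
      unfolding C_def using ne that(1) y
      by (intro cInf_greatest) (auto simp: pos_divide_le_eq)
    then show ?thesis using y by (simp add: pos_divide_le_eq)
  qed
  ultimately have "?P C"
    unfolding signed_democratic_bound_def by auto
  then show ?thesis using le D unfolding is_least_def by blast
qed

section \<open>Coordinate estimates\<close>

lemma (in banach_space_over) coordinate_signed_indicator_sum:
  assumes basis: "is_basis scl e es" and "finite B"
  shows "es i (signed_indicator_sum scl e \<epsilon> B) = (if i \<in> B then \<epsilon> i else 0)"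
proof -
  interpret f: Vector_Spaces.linear scl "(*)" "es i"
    using basis unfolding is_basis_def dual_functional_def by blast
  have "es i (signed_indicator_sum scl e \<epsilon> B) = (\<Sum>j\<in>B. \<epsilon> j * es i (e j))"
    unfolding signed_indicator_sum_def by (simp add: f.sum f.scale)
  also have "\<dots> = (\<Sum>j\<in>B. if j = i then \<epsilon> i else 0)"
    using basis unfolding is_basis_def by (intro sum.cong) auto
  finally show ?thesis using assms(2) by simp
qed

lemma (in banach_space_over) norm_signed_indicator_sum_le:
  assumes basis: "is_basis scl e es" and "\<epsilon> \<in> unimodular A"
  shows "norm (signed_indicator_sum scl e \<epsilon> A) \<le> real (card A) * alpha1 e"
proof -
  obtain M where "\<And>i. max (norm (e i)) (onorm (es i)) \<le> M"
    using basis unfolding is_basis_def bdd_above_def by auto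
  then have bdd: "bdd_above (range (\<lambda>i. norm (e i)))" by (intro bdd_aboveI[of _ M]) auto
  have "norm (signed_indicator_sum scl e \<epsilon> A) \<le> (\<Sum>i\<in>A. norm (scl (\<epsilon> i) (e i)))"
    unfolding signed_indicator_sum_def by (rule norm_sum)
  also have "\<dots> = (\<Sum>i\<in>A. norm (e i))"
    using assms(2) by (intro sum.cong) (auto simp: norm_scl unimodular_def)
  also have "\<dots> \<le> (\<Sum>i\<in>A. alpha1 e)"
    unfolding alpha1_def by (intro sum_mono cSUP_upper bdd UNIV_I)
  finally show ?thesis by simp
qed

lemma (in banach_space_over) one_le_alpha2_norm_signed_indicator_sum:
  assumes basis: "is_basis scl e es" and "finite B" "B \<noteq> {}" "\<epsilon> \<in> unimodular B"
  shows "1 \<le> alpha2 es * norm (signed_indicator_sum scl e \<epsilon> B)"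
proof -
  obtain M where "\<And>i. max (norm (e i)) (onorm (es i)) \<le> M"
    using basis unfolding is_basis_def bdd_above_def by auto
  then have bdd: "bdd_above (range (\<lambda>i. onorm (es i)))" by (intro bdd_aboveI[of _ M]) auto
  obtain i where i: "i \<in> B" using assms(3) by blast
  have "bounded_linear (es i)" using basis unfolding is_basis_def dual_functional_def by blast
  then have "norm (es i (signed_indicator_sum scl e \<epsilon> B))
      \<le> onorm (es i) * norm (signed_indicator_sum scl e \<epsilon> B)" by (rule onorm)
  also have "\<dots> \<le> alpha2 es * norm (signed_indicator_sum scl e \<epsilon> B)"
    unfolding alpha2_def by (intro mult_right_mono cSUP_upper bdd UNIV_I norm_ge_zero)
  finally show ?thesis
    using i assms(4) by (simp add: coordinate_signed_indicator_sum[OF basis assms(2)] unimodular_def)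
qed

text \<open>
  Only initial segments of \<open>B\<close> arise from partial sums; passing to an arbitrary subset at a uniform
  price would amount to a form of unconditionality.  This is why \<open>B\<close> is shrunk to its smallest
  elements.
\<close>

lemma (in banach_space_over) norm_initial_segment_le:
  assumes basis: "is_basis scl e es" and K: "partial_sums_bounded_by scl e es K" and "finite B"
  shows "norm (signed_indicator_sum scl e \<epsilon> (B \<inter> {..<m}))
    \<le> K * norm (signed_indicator_sum scl e \<epsilon> B)"
proof -
  have "(\<Sum>i<m. scl (es i (signed_indicator_sum scl e \<epsilon> B)) (e i))
      = (\<Sum>i<m. if i \<in> B then scl (\<epsilon> i) (e i) else 0)"
    by (intro sum.cong) (auto simp: coordinate_signed_indicator_sum[OF basis assms(3)])
  also have "\<dots> = signed_indicator_sum scl e \<epsilon> (B \<inter> {..<m})"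
    unfolding signed_indicator_sum_def
    by (simp add: sum.inter_restrict[symmetric] Int_commute)
  finally show ?thesis using K unfolding partial_sums_bounded_by_def by metis
qed

section \<open>Removing the restriction on cardinalities\<close>

lemma (in banach_space_over) signed_democratic_bound_all_cards:
  assumes n: "strict_mono n" "0 < n 0" and gaps: "bounded_quotient_gaps l n"
    and basis: "is_basis scl e es" and K: "partial_sums_bounded_by scl e es K"
    and unimod: "\<And>A. U A \<subseteq> unimodular A"
    and shrink: "\<And>A S. S \<subseteq> A \<Longrightarrow> U A \<subseteq> U S"
    and D: "signed_democratic_bound U (range n) scl e D"
  shows "signed_democratic_bound U {1..} scl e
    (max ((real (n 0) - 1) * alpha1 e * alpha2 es) (real l * K * D))"
    (is "signed_democratic_bound _ _ _ _ (max ?a ?b)")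
proof -
  let ?s = "signed_indicator_sum scl e"
  have Kpos: "0 < K" and Dpos: "0 < D"
    using K D unfolding partial_sums_bounded_by_def signed_democratic_bound_def by auto
  have npos: "0 < n k" for k
    using n by (metis bot_nat_0.extremum less_le_trans strict_mono_less_eq)
  have lpos: "0 < l"
  proof -
    have "0 < real (n (Suc 0)) / real (n 0)" using npos by simp
    also have "\<dots> \<le> real l" using gaps unfolding bounded_quotient_gaps_def by blast
    finally show ?thesis by simp
  qed
  have "norm (?s \<epsilon> A) \<le> max ?a ?b * norm (?s \<epsilon>' B)"
    if fin: "finite A" "finite B" and AB: "card A \<le> card B" and A1: "1 \<le> card A"
      and \<epsilon>: "\<epsilon> \<in> U A" and \<epsilon>': "\<epsilon>' \<in> U B" for A B \<epsilon> \<epsilon>'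
  proof (cases "card A < n 0")
    case True
    have alpha1: "0 \<le> alpha1 e"
      using norm_signed_indicator_sum_le[OF basis, of "\<lambda>_. 1" "{0}"]
      by (simp add: unimodular_def) (meson norm_ge_zero order_trans)
    have "B \<noteq> {}" using A1 AB by auto
    then have B: "1 \<le> alpha2 es * norm (?s \<epsilon>' B)"
      using one_le_alpha2_norm_signed_indicator_sum[OF basis fin(2)] \<epsilon>' unimod by blast
    have "norm (?s \<epsilon> A) \<le> real (card A) * alpha1 e"
      using norm_signed_indicator_sum_le[OF basis] \<epsilon> unimod by blast
    also have "\<dots> \<le> (real (n 0) - 1) * alpha1 e"
      using True alpha1 by (intro mult_right_mono) auto
    also have "\<dots> \<le> (real (n 0) - 1) * alpha1 e * (alpha2 es * norm (?s \<epsilon>' B))"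
      using mult_left_mono[OF B, of "(real (n 0) - 1) * alpha1 e"] alpha1 n(2) by simp
    also have "\<dots> = ?a * norm (?s \<epsilon>' B)" by simp
    also have "\<dots> \<le> max ?a ?b * norm (?s \<epsilon>' B)" by (intro mult_right_mono) auto
    finally show ?thesis .
  next
    case False
    then obtain k where k: "n k \<le> card A" "card A < n (Suc k)"
      using strict_mono_bracket[OF n(1), of "card A"] by auto
    obtain m where m: "card (B \<inter> {..<m}) = n k"
      using ex_initial_segment_card[OF fin(2)] k(1) AB by (meson order_trans)
    let ?M = "D * (K * norm (?s \<epsilon>' B))"
    have piece: "norm (sum (\<lambda>i. scl (\<epsilon> i) (e i)) S) \<le> ?M" if S: "S \<subseteq> A" "card S = n k" for S
    proof -
      have "\<epsilon> \<in> U S" using \<epsilon> shrink[OF S(1)] by blast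
      moreover have "\<epsilon>' \<in> U (B \<inter> {..<m})" using \<epsilon>' shrink[of "B \<inter> {..<m}" B] by blast
      moreover have "finite S" using S(1) fin(1) by (rule finite_subset)
      ultimately have "norm (?s \<epsilon> S) \<le> D * norm (?s \<epsilon>' (B \<inter> {..<m}))"
        using D fin(2) m S(2) unfolding signed_democratic_bound_def by simp
      also have "\<dots> \<le> ?M"
        using norm_initial_segment_le[OF basis K fin(2)] Dpos by (intro mult_left_mono) auto
      finally show ?thesis unfolding signed_indicator_sum_def .
    qed
    have "real (n (Suc k)) / real (n k) \<le> real l"
      using gaps unfolding bounded_quotient_gaps_def by blast
    then have "real (n (Suc k)) \<le> real l * real (n k)" using npos by (simp add: pos_divide_le_eq)
    then have quot: "real (card A) \<le> real l * real (n k)" using k(2) by linarith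
    have "real (n k) * norm (?s \<epsilon> A) \<le> real (card A) * ?M"
      unfolding signed_indicator_sum_def[of _ _ \<epsilon> A]
      using fin(1) npos k(1) piece by (rule norm_sum_le_by_subset_average)
    also have "\<dots> \<le> real l * real (n k) * ?M"
      using quot Kpos Dpos by (intro mult_right_mono) auto
    also have "\<dots> = real (n k) * (?b * norm (?s \<epsilon>' B))" by simp
    finally have "norm (?s \<epsilon> A) \<le> ?b * norm (?s \<epsilon>' B)" using npos[of k] by simp
    also have "\<dots> \<le> max ?a ?b * norm (?s \<epsilon>' B)" by (intro mult_right_mono) auto
    finally show ?thesis .
  qed
  moreover have "0 < max ?a ?b" using lpos Kpos Dpos by (simp add: less_max_iff_disj)
  ultimately show ?thesis unfolding signed_democratic_bound_def by auto
qed

theorem proposition3p6: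
  fixes scl :: "'k::real_normed_field \<Rightarrow> 'a::banach \<Rightarrow> 'a"
    and e :: "nat \<Rightarrow> 'a" and es :: "nat \<Rightarrow> 'a \<Rightarrow> 'k"
    and n :: "nat \<Rightarrow> nat" and l :: nat and K :: real
  assumes "banach_space_over scl"
    and "separable_inf_dim scl"
    and "strict_mono n" and "0 < n 0"
    and "2 \<le> l" and "bounded_quotient_gaps l n"
    and "schauder_basis scl e es"
    and "basis_constant scl e es K"
  shows
    "(\<forall>\<Delta>\<^sub>d. democratic_with (range n) e \<Delta>\<^sub>d \<longrightarrow>
        (\<exists>C. democratic_with {1..} e C \<and>
             C \<le> max ((real (n 0) - 1) * alpha1 e * alpha2 es) (real l * K * \<Delta>\<^sub>d))) \<and>
     (\<forall>\<Delta>\<^sub>s. superdemocratic_with (range n) scl e \<Delta>\<^sub>s \<longrightarrow>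
        (\<exists>C. superdemocratic_with {1..} scl e C \<and>
             C \<le> max ((real (n 0) - 1) * alpha1 e * alpha2 es) (real l * K * \<Delta>\<^sub>s)))"
proof -
  interpret banach_space_over scl by fact
  have basis: "is_basis scl e es" using assms(7) unfolding schauder_basis_def by blast
  have K: "partial_sums_bounded_by scl e es K"
    using assms(8) unfolding basis_constant_def is_least_def by blast
  have e0: "e 0 \<noteq> 0"
    using one_le_alpha2_norm_signed_indicator_sum[OF basis, of "{0}" "\<lambda>_. 1"]
    by (auto simp: signed_indicator_sum_def unimodular_def)
  have least: "\<exists>C. is_least (signed_democratic_bound U {1..} scl e) C \<and>
      C \<le> max ((real (n 0) - 1) * alpha1 e * alpha2 es) (real l * K * D)"
    if "\<And>A. U A \<subseteq> unimodular A" "\<And>A S. S \<subseteq> A \<Longrightarrow> U A \<subseteq> U S" "(\<lambda>_. 1) \<in> U {0}"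
      "is_least (signed_democratic_bound U (range n) scl e) D" for U D
  proof (rule ex_least_signed_democratic_bound)
    have D: "signed_democratic_bound U (range n) scl e D"
      using that(4) unfolding is_least_def by blast
    show "signed_democratic_bound U {1..} scl e
        (max ((real (n 0) - 1) * alpha1 e * alpha2 es) (real l * K * D))"
      using assms(3,4,6) basis K that(1,2) D by (rule signed_democratic_bound_all_cards)
  qed (use e0 that(3) in auto)
  show ?thesis
    unfolding democratic_with_def superdemocratic_with_def
      superdemocratic_bound_eq_signed democratic_bound_eq_signed
    by (intro conjI allI impI least) (auto simp: unimodular_def)
qed

end
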